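(* Fix a scenario $\omega$, and let the futures market quantities $q_k^F$ ($k\in I\cup J$) and the futures allowance commitments $\varepsilon_i^F$ ($i\in I$) be given. Assume that $\beta_\omega^S(1+\delta_i)+c_{i\omega}\neq 0$ for every $i\in I$, put $$\tau_{i\omega}=\frac{1}{\beta_{\omega}^S(1+\delta_i)+c_{i\omega}}\quad (i\in I),$$ assume $1+\beta_\omega^S\sum_{i\in I}\tau_{i\omega}\neq 0$, and put $$\varphi_{\omega}=\frac{1}{1+\beta_{\omega}^S\sum_{i\in I}\tau_{i\omega}}.$$ If $\big((q_{i\omega}^S)_{i\in I},P_\omega^S\big)$ is a spot market equilibrium in scenario $\omega$ with conjectural parameters $(\delta_i)_{i\in I}$, then for every $i\in I$ the equilibrium spot quantity is $$q_{i\omega}^S =\tau_{i\omega}\varphi_{\omega}\left[\hat{\gamma}_{\omega}^{S}+\beta_{\omega}^S\sum_{l\in I}\tau_{l\omega}\left(b_{l\omega}+c_{l\omega}q_{l}^F+\hat{\eta}_{l\omega}P_{\omega}^{S_{CO_2}}\right)-\beta_{\omega}^S\sum_{l\in I}q_l^F\right]-\tau_{i\omega}\left[b_{i\omega}+c_{i\omega}q_{i}^F+\hat{\eta}_{i\omega}P_{\omega}^{S_{CO_2}}\right].$$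
   Context: $I$ is a finite set of conventional generators, $J$ a finite set of renewable generators, and $\omega$ denotes a scenario. In scenario $\omega$ the following real parameters are given: $\gamma_\omega^S>0$ and $\beta_\omega^S>0$ (spot inverse demand intercept and slope); the renewable productions $Q_{j\omega}$ ($j\in J$), which are always fully dispatched; cost coefficients $a_{i\omega},b_{i\omega},c_{i\omega}\ge 0$ ($i\in I$); emission intensity factors $\hat\eta_{i\omega}$ ($i\in I$); and the exogenous spot price of emission allowances $P_\omega^{S_{CO_2}}$. The futures quantities $q_k^F$ ($k\in I\cup J$), the futures price, and the futures allowance commitments $\varepsilon_i^F$ ($i\in I$) are already settled and are treated as fixed real constants in the spot market. Spot quantities $q_{i\omega}^S$ ($i\in I$) are unconstrained real numbers. Production cost of conventional generator $i$: $C_{i\omega}(q_i^F,q_{i\omega}^S)=a_{i\omega}+b_{i\omega}(q_i^F+q_{i\omega}^S)+\tfrac12 c_{i\omega}(q_i^F+q_{i\omega}^S)^2$. Spot profit of conventional generator $i$: $$\Pi_{i\omega}^S=P^S_{\omega}q_{i\omega}^S-C_{i\omega}(q_i^F,q_{i\omega}^S)+P_{\omega}^{S_{CO_2}}\big(\varepsilon_{i}^F-\hat{\eta}_{i\omega}(q_i^F+q_{i\omega}^S)\big).$$ Spot inverse demand: $P_{\omega}^{S}=\hat{\gamma}_{\omega}^{S}-\beta_{\omega}^S\sum_{i\in I}(q_{i\omega}^S+q_i^F)$, where $\hat{\gamma}_{\omega}^{S}=\gamma_{\omega}^{S}-\beta_{\omega}^S\sum_{j\in J}Q_{j\omega}$.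 Conjectures: each $i\in I$ has a given real constant $\delta_i=\sum_{k\in I,\,k\neq i}\frac{\partial q_{k\omega}^S}{\partial q_{i\omega}^S}$, the total response of its rivals' spot quantities that it conjectures ($\delta_i=-1$ represents perfect competition, $\delta_i=0$ Cournot competition). Hence generator $i$ perceives $\frac{\partial P_\omega^S}{\partial q_{i\omega}^S}=-\beta_\omega^S(1+\delta_i)$. A spot market equilibrium in scenario $\omega$ is a pair $\big((q_{i\omega}^S)_{i\in I},P_\omega^S\big)$ of real quantities and a real price such that the spot inverse demand relation holds and, simultaneously for every $i\in I$, the first-order condition for maximizing $\Pi_{i\omega}^S$ with respect to $q_{i\omega}^S$ holds, the derivative being computed with generator $i$'s perceived price derivative. That is, at $x=q_{i\omega}^S$ the derivative in $x$ of $$x\mapsto \big(P_\omega^S-\beta_\omega^S(1+\delta_i)(x-q_{i\omega}^S)\big)x-C_{i\omega}(q_i^F,x)+P_{\omega}^{S_{CO_2}}\big(\varepsilon_{i}^F-\hat{\eta}_{i\omega}(q_i^F+x)\big)$$ is zero. *)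

theory Defs
  imports Complex_Main
begin

definition production_cost :: "real \<Rightarrow> real \<Rightarrow> real \<Rightarrow> real \<Rightarrow> real \<Rightarrow> real" where
  "production_cost a b c qF qS = a + b * (qF + qS) + 1 / 2 * c * (qF + qS)\<^sup>2"

definition spot_profit ::
  "real \<Rightarrow> real \<Rightarrow> real \<Rightarrow> real \<Rightarrow> real \<Rightarrow> real \<Rightarrow> real \<Rightarrow> real \<Rightarrow> real \<Rightarrow> real" where
  "spot_profit a b c \<eta> PC qF \<epsilon>F PS qS =
     PS * qS - production_cost a b c qF qS + PC * (\<epsilon>F - \<eta> * (qF + qS))"

text \<open>The demand intercept net of the fully dispatched renewable production.\<close>

definition net_intercept ::
  "'k set \<Rightarrow> ('s \<Rightarrow> real) \<Rightarrow> ('s \<Rightarrow> real) \<Rightarrow> ('k \<Rightarrow> 's \<Rightarrow> real) \<Rightarrow> 's \<Rightarrow> real" where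
  "net_intercept J \<gamma> \<beta> Q \<omega> = \<gamma> \<omega> - \<beta> \<omega> * (\<Sum>j\<in>J. Q j \<omega>)"

text \<open>
  The spot price that a generator expects when it deviates unilaterally from quantity \<open>q\<close> to
  \<open>x\<close> at current price \<open>PS\<close>: the conjectured total response \<open>\<delta>\<close> of its rivals makes the
  perceived price derivative equal to \<open>- \<beta> * (1 + \<delta>)\<close>.
\<close>

definition perceived_price :: "real \<Rightarrow> real \<Rightarrow> real \<Rightarrow> real \<Rightarrow> real \<Rightarrow> real" where
  "perceived_price \<beta> \<delta> PS q x = PS - \<beta> * (1 + \<delta>) * (x - q)"

text \<open>
  Generators in \<open>I\<close> are conventional, those in \<open>J\<close> renewable. Quantities and parameters that
  depend on the scenario carry the argument \<open>\<omega>\<close>; futures positions \<open>qF\<close>, \<open>\<epsilon>F\<close> and conjectures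
  \<open>\<delta>\<close> do not. \<open>PC\<close> is the spot price of emission allowances.
\<close>

definition spot_equilibrium ::
  "'k set \<Rightarrow> 'k set \<Rightarrow> ('s \<Rightarrow> real) \<Rightarrow> ('s \<Rightarrow> real) \<Rightarrow> ('k \<Rightarrow> 's \<Rightarrow> real) \<Rightarrow>
   ('k \<Rightarrow> 's \<Rightarrow> real) \<Rightarrow> ('k \<Rightarrow> 's \<Rightarrow> real) \<Rightarrow> ('k \<Rightarrow> 's \<Rightarrow> real) \<Rightarrow>
   ('k \<Rightarrow> 's \<Rightarrow> real) \<Rightarrow> ('s \<Rightarrow> real) \<Rightarrow> ('k \<Rightarrow> real) \<Rightarrow> ('k \<Rightarrow> real) \<Rightarrow> ('k \<Rightarrow> real) \<Rightarrow>
   's \<Rightarrow> ('k \<Rightarrow> 's \<Rightarrow> real) \<Rightarrow> ('s \<Rightarrow> real) \<Rightarrow> bool" where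
  "spot_equilibrium I J \<gamma> \<beta> Q a b c \<eta> PC qF \<epsilon>F \<delta> \<omega> qS PS \<longleftrightarrow>
     PS \<omega> = net_intercept J \<gamma> \<beta> Q \<omega> - \<beta> \<omega> * (\<Sum>i\<in>I. qS i \<omega> + qF i) \<and>
     (\<forall>i\<in>I.
       ((\<lambda>x. spot_profit (a i \<omega>) (b i \<omega>) (c i \<omega>) (\<eta> i \<omega>) (PC \<omega>) (qF i) (\<epsilon>F i)
               (perceived_price (\<beta> \<omega>) (\<delta> i) (PS \<omega>) (qS i \<omega>) x) x)
         has_real_derivative 0) (at (qS i \<omega>)))"

end

theory Submission
  imports Defs
begin

text \<open>
  The first-order condition of generator \<open>i\<close> is affine in its quantity and gives
  \<open>q\<^sub>i = \<tau>\<^sub>i (P - K\<^sub>i)\<close> with \<open>K\<^sub>i = b\<^sub>i + c\<^sub>i q\<^sub>i\<^sup>F + \<eta>\<^sub>i P\<^sup>C\<close>.  Summing over \<open>i\<close> and inserting the result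
  into the inverse demand relation leaves one linear equation for the price \<open>P\<close>, whose solution
  is \<open>\<phi>\<close> times the bracket of the formula.
\<close>

text \<open>At \<open>x = q\<close> the perceived price equals \<open>PS\<close> and has slope
  \<open>- \<beta> * (1 + \<delta>)\<close>, so the product rule gives marginal revenue
  \<open>PS - \<beta> * (1 + \<delta>) * q\<close>; the other terms are marginal production and
  emission costs.\<close>

lemma spot_profit_perceived_deriv:
  "((\<lambda>x. spot_profit a b c \<eta> PC qF \<epsilon>F (perceived_price \<beta> \<delta> PS q x) x)
     has_real_derivative PS - \<beta> * (1 + \<delta>) * q - b - c * (qF + q) - PC * \<eta>) (at q)"
  unfolding spot_profit_def perceived_price_def production_cost_def
  by (auto intro!: derivative_eq_intros simp: algebra_simps)

theorem proposition2:
  fixes I J :: "'k set"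
    and \<omega> :: 's
    and \<gamma> \<beta> PC PS \<phi> :: "'s \<Rightarrow> real"
    and Q a b c \<eta> qS \<tau> :: "'k \<Rightarrow> 's \<Rightarrow> real"
    and qF \<epsilon>F \<delta> :: "'k \<Rightarrow> real"
  assumes "finite I" and "finite J"
    and "\<gamma> \<omega> > 0" and "\<beta> \<omega> > 0"
    and "\<And>i. i \<in> I \<Longrightarrow> a i \<omega> \<ge> 0 \<and> b i \<omega> \<ge> 0 \<and> c i \<omega> \<ge> 0"
    and "\<And>i. i \<in> I \<Longrightarrow> \<beta> \<omega> * (1 + \<delta> i) + c i \<omega> \<noteq> 0"
    and "\<And>i. i \<in> I \<Longrightarrow> \<tau> i \<omega> = 1 / (\<beta> \<omega> * (1 + \<delta> i) + c i \<omega>)"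
    and "1 + \<beta> \<omega> * (\<Sum>i\<in>I. \<tau> i \<omega>) \<noteq> 0"
    and "\<phi> \<omega> = 1 / (1 + \<beta> \<omega> * (\<Sum>i\<in>I. \<tau> i \<omega>))"
    and "spot_equilibrium I J \<gamma> \<beta> Q a b c \<eta> PC qF \<epsilon>F \<delta> \<omega> qS PS"
  shows "\<forall>i\<in>I. qS i \<omega> =
    \<tau> i \<omega> * \<phi> \<omega> *
      (net_intercept J \<gamma> \<beta> Q \<omega>
        + \<beta> \<omega> * (\<Sum>l\<in>I. \<tau> l \<omega> * (b l \<omega> + c l \<omega> * qF l + \<eta> l \<omega> * PC \<omega>))
        - \<beta> \<omega> * (\<Sum>l\<in>I. qF l))
    - \<tau> i \<omega> * (b i \<omega> + c i \<omega> * qF i + \<eta> i \<omega> * PC \<omega>)"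
proof
  \<comment> \<open>\<open>K l\<close> is the marginal cost, allowances included, of generator
    \<open>l\<close> at spot quantity zero.\<close>
  define K where "K l = b l \<omega> + c l \<omega> * qF l + \<eta> l \<omega> * PC \<omega>" for l
  have price: "PS \<omega> = net_intercept J \<gamma> \<beta> Q \<omega> - \<beta> \<omega> * (\<Sum>i\<in>I. qS i \<omega> + qF i)"
    using assms(10) unfolding spot_equilibrium_def by blast
  have quantity: "qS i \<omega> = \<tau> i \<omega> * (PS \<omega> - K i)" if "i \<in> I" for i
  proof -
    \<comment> \<open>A derivative is unique, so the computed one equals the 0 required by
      equilibrium.\<close>
    have "PS \<omega> - \<beta> \<omega> * (1 + \<delta> i) * qS i \<omega> - b i \<omega> - c i \<omega> * (qF i + qS i \<omega>) - PC \<omega> * \<eta> i \<omega> = 0"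
      using assms(10) that DERIV_unique[OF spot_profit_perceived_deriv]
      unfolding spot_equilibrium_def by blast
    \<comment> \<open>The collected coefficient of \<open>qS i \<omega>\<close> is nonzero by
      assumption, with reciprocal \<open>\<tau> i \<omega>\<close>.\<close>
    then have "(\<beta> \<omega> * (1 + \<delta> i) + c i \<omega>) * qS i \<omega> = PS \<omega> - K i"
      by (simp add: K_def algebra_simps)
    then show ?thesis
      using assms(6)[OF that] unfolding assms(7)[OF that] by (simp add: eq_divide_eq mult.commute)
  qed
  have "(\<Sum>i\<in>I. qS i \<omega>) = PS \<omega> * (\<Sum>i\<in>I. \<tau> i \<omega>) - (\<Sum>i\<in>I. \<tau> i \<omega> * K i)"
    by (simp add: quantity sum_distrib_left sum_subtractf algebra_simps)
  with price have "PS \<omega> * (1 + \<beta> \<omega> * (\<Sum>i\<in>I. \<tau> i \<omega>)) =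
      net_intercept J \<gamma> \<beta> Q \<omega> + \<beta> \<omega> * (\<Sum>l\<in>I. \<tau> l \<omega> * K l) - \<beta> \<omega> * (\<Sum>l\<in>I. qF l)"
    by (simp add: sum.distrib algebra_simps)
  then have price_solved: "PS \<omega> = \<phi> \<omega> *
      (net_intercept J \<gamma> \<beta> Q \<omega> + \<beta> \<omega> * (\<Sum>l\<in>I. \<tau> l \<omega> * K l) - \<beta> \<omega> * (\<Sum>l\<in>I. qF l))"
    using assms(8) unfolding assms(9) by (simp add: eq_divide_eq)
  fix i assume "i \<in> I"
  \<comment> \<open>Distributing \<open>\<tau> i \<omega>\<close> matches the shape of the goal, so
    inserting the solved price leaves only reassociation and unfolding \<open>K\<close>.\<close>
  then have "qS i \<omega> = \<tau> i \<omega> * PS \<omega> - \<tau> i \<omega> * K i"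
    by (simp add: quantity right_diff_distrib)
  then show "qS i \<omega> =
    \<tau> i \<omega> * \<phi> \<omega> *
      (net_intercept J \<gamma> \<beta> Q \<omega>
        + \<beta> \<omega> * (\<Sum>l\<in>I. \<tau> l \<omega> * (b l \<omega> + c l \<omega> * qF l + \<eta> l \<omega> * PC \<omega>))
        - \<beta> \<omega> * (\<Sum>l\<in>I. qF l))
    - \<tau> i \<omega> * (b i \<omega> + c i \<omega> * qF i + \<eta> i \<omega> * PC \<omega>)"
    by (subst (asm) price_solved) (simp only: K_def mult.assoc)
qed

end
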